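(* Let $k$ be a positive integer, $S^k=\{(x_0,\dots,x_k)\in\mathbb{R}^{k+1}\mid\sum_i x_i^2=1\}$, $O$ the origin of $\mathbb{R}^{k+1}$, $A=e=(1,0,\dots,0)$, and identify $\mathbb{R}^k$ with $\mathbb{T}=\{1\}\times\mathbb{R}^k\subseteq\mathbb{R}^{k+1}$. Define the homeomorphism $\varphi:S^k\setminus\{-e\}\to\mathbb{T}$ as follows: for $P\in S^k\setminus\{-e\}$, let $U$ be the unit vector along the bisector of the angle $\angle AOP$ (in the plane of $A,O,P$; $U=e$ if $P=e$), and let $\varphi(P)$ be the point where the ray from $O$ in direction $U$ meets $\mathbb{T}$ (so $\varphi(A)=A$). Then: (1) If $Y\subseteq\mathbb{T}$ is a dense rational set containing $A$ such that the distances from $A$ to the points of $Y$ are all elliptic rationals (i.e. lie in $\mathbb{Q}^{+}_{elliptic}\cup\{0\}$), then $X=\varphi^{-1}(Y)\subseteq S^k$ is a dense rational set in $S^k$ containing $A$ such that all distances from $A$ to points of $X$ lie in $2(\mathbb{Q}^{+}_{hyperbolic}\cup\{0\})$. (2) The following two statements are equivalent: (a) for every positive integer $k$ there exists an elliptic rational set $X\subseteq\mathbb{R}^k$ which is dense in $\mathbb{R}^k$; (b) for every positive integer $k$ there exists a $2$-hyperbolic rational set $X\subseteq S^k$ which is dense in $S^k$. More precisely, for each fixed $k$, (a) holds for $k$ if and only if (b) holds for $k$.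
   Context: Distances are Euclidean. A set is a rational set if all pairwise distances between its points are rational (nonnegative). A rational $r=p/q$ in lowest terms is an elliptic rational if $p^2+q^2$ is a perfect square, and a hyperbolic rational if $p^2-q^2=\pm m^2$ for some integer $m$; $\mathbb{Q}^{+}_{elliptic}$, $\mathbb{Q}^{+}_{hyperbolic}$ denote the positive ones. For a positive rational $l$, an $l$-elliptic (resp. $l$-hyperbolic) rational set is a rational set $X$ containing a point $P$ with $\{d(P,x)\mid x\in X\}\subseteq l(\mathbb{Q}^{+}_{elliptic}\cup\{0\})$ (resp. $\subseteq l(\mathbb{Q}^{+}_{hyperbolic}\cup\{0\})$); an elliptic rational set is an $l$-elliptic rational set for some positive rational $l$. *)

theory Defs
  imports "HOL-Analysis.Analysis"
begin

text \<open>
  A point of \<open>\<real>\<^sup>n\<close> is a function \<open>nat \<Rightarrow> real\<close> vanishing at all indices \<open>\<ge> n\<close>, i.e. an element of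
  \<open>topspace (Euclidean_space n)\<close>; the sphere in \<open>\<real>\<^sup>k\<^sup>+\<^sup>1\<close> is \<open>nsphere k\<close>, whose coordinates are
  numbered \<open>0, \<dots>, k\<close>. The subspace topologies of these library spaces are the Euclidean ones.
  The type class \<open>dist\<close> on \<open>nat \<Rightarrow> real\<close> is a different metric, hence the explicit Euclidean
  norm, inner product and distance below.
\<close>

definition edist :: "nat \<Rightarrow> (nat \<Rightarrow> real) \<Rightarrow> (nat \<Rightarrow> real) \<Rightarrow> real" where
  "edist n x y = L2_set (\<lambda>i. x i - y i) {..<n}"

definition einner :: "nat \<Rightarrow> (nat \<Rightarrow> real) \<Rightarrow> (nat \<Rightarrow> real) \<Rightarrow> real" where
  "einner n x y = (\<Sum>i<n. x i * y i)"

definition enorm :: "nat \<Rightarrow> (nat \<Rightarrow> real) \<Rightarrow> real" where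
  "enorm n x = L2_set x {..<n}"

text \<open>The angle at the origin between two nonzero vectors, in the interval from \<open>0\<close> to \<open>pi\<close>.\<close>

definition eangle :: "nat \<Rightarrow> (nat \<Rightarrow> real) \<Rightarrow> (nat \<Rightarrow> real) \<Rightarrow> real" where
  "eangle n x y = arccos (einner n x y / (enorm n x * enorm n y))"

definition dense_in :: "'a topology \<Rightarrow> 'a set \<Rightarrow> bool" where
  "dense_in T X \<longleftrightarrow> X \<subseteq> topspace T \<and> T closure_of X = topspace T"


definition pos_elliptic_rationals :: "real set" where
  "pos_elliptic_rationals =
     {r. r > 0 \<and> (\<exists>p q :: int. q > 0 \<and> coprime p q \<and> r = of_int p / of_int q \<and>
                    (\<exists>m :: int. p\<^sup>2 + q\<^sup>2 = m\<^sup>2))}"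

definition pos_hyperbolic_rationals :: "real set" where
  "pos_hyperbolic_rationals =
     {r. r > 0 \<and> (\<exists>p q :: int. q > 0 \<and> coprime p q \<and> r = of_int p / of_int q \<and>
                    (\<exists>m :: int. p\<^sup>2 - q\<^sup>2 = m\<^sup>2 \<or> p\<^sup>2 - q\<^sup>2 = - (m\<^sup>2)))}"

definition rational_set :: "nat \<Rightarrow> (nat \<Rightarrow> real) set \<Rightarrow> bool" where
  "rational_set n X \<longleftrightarrow>
     X \<subseteq> topspace (Euclidean_space n) \<and> (\<forall>x\<in>X. \<forall>y\<in>X. edist n x y \<in> \<rat>)"

definition l_elliptic_rational_set :: "nat \<Rightarrow> real \<Rightarrow> (nat \<Rightarrow> real) set \<Rightarrow> bool" where
  "l_elliptic_rational_set n l X \<longleftrightarrow>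
     l \<in> \<rat> \<and> l > 0 \<and> rational_set n X \<and>
     (\<exists>P\<in>X. {edist n P x | x. x \<in> X} \<subseteq> (\<lambda>r. l * r) ` (pos_elliptic_rationals \<union> {0}))"

definition l_hyperbolic_rational_set :: "nat \<Rightarrow> real \<Rightarrow> (nat \<Rightarrow> real) set \<Rightarrow> bool" where
  "l_hyperbolic_rational_set n l X \<longleftrightarrow>
     l \<in> \<rat> \<and> l > 0 \<and> rational_set n X \<and>
     (\<exists>P\<in>X. {edist n P x | x. x \<in> X} \<subseteq> (\<lambda>r. l * r) ` (pos_hyperbolic_rationals \<union> {0}))"

definition elliptic_rational_set :: "nat \<Rightarrow> (nat \<Rightarrow> real) set \<Rightarrow> bool" where
  "elliptic_rational_set n X \<longleftrightarrow> (\<exists>l. l_elliptic_rational_set n l X)"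


definition e0 :: "nat \<Rightarrow> real" where
  "e0 = (\<lambda>i. if i = 0 then 1 else 0)"

definition neg_e0 :: "nat \<Rightarrow> real" where
  "neg_e0 = (\<lambda>i. - e0 i)"

definition punctured_sphere :: "nat \<Rightarrow> (nat \<Rightarrow> real) topology" where
  "punctured_sphere k = subtopology (nsphere k) (- {neg_e0})"

text \<open>The hyperplane \<open>{1} \<times> \<real>\<^sup>k\<close> of \<open>\<real>\<^sup>k\<^sup>+\<^sup>1\<close>.\<close>

definition tangent_space :: "nat \<Rightarrow> (nat \<Rightarrow> real) topology" where
  "tangent_space k = subtopology (Euclidean_space (Suc k)) {x. x 0 = 1}"

text \<open>
  The unit vector along the bisector of the angle \<open>AOP\<close>, where \<open>A = e0\<close>: it lies in the plane of
  \<open>A\<close>, \<open>O\<close>, \<open>P\<close> and makes half of the angle \<open>AOP\<close> with each side. For \<open>P\<close> on the sphere other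
  than \<open>A\<close> and \<open>-A\<close> it is unique; for \<open>P = -A\<close> the value is irrelevant.
\<close>

definition is_unit_bisector :: "nat \<Rightarrow> (nat \<Rightarrow> real) \<Rightarrow> (nat \<Rightarrow> real) \<Rightarrow> bool" where
  "is_unit_bisector k P U \<longleftrightarrow>
     (\<exists>a b. U = (\<lambda>i. a * e0 i + b * P i)) \<and> enorm (Suc k) U = 1 \<and>
     eangle (Suc k) e0 U = eangle (Suc k) e0 P / 2 \<and>
     eangle (Suc k) U P = eangle (Suc k) e0 P / 2"

definition unit_bisector :: "nat \<Rightarrow> (nat \<Rightarrow> real) \<Rightarrow> (nat \<Rightarrow> real)" where
  "unit_bisector k P = (if P = e0 then e0 else (THE U. is_unit_bisector k P U))"

definition phi :: "nat \<Rightarrow> (nat \<Rightarrow> real) \<Rightarrow> (nat \<Rightarrow> real)" where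
  "phi k P = (THE Q. Q \<in> topspace (tangent_space k) \<and>
                     (\<exists>t\<ge>0. Q = (\<lambda>i. t * unit_bisector k P i)))"

end

theory Submission
  imports Defs
begin

text \<open>
  In coordinates \<open>\<phi>(P) = (P + e) / (1 + P\<^sub>0)\<close>, with inverse \<open>\<psi>(y) = 2 y / |y|\<^sup>2 - e\<close>, and
  \<open>|\<psi>(y) - \<psi>(z)| = 2 |y - z| / (|y| |z|)\<close> for \<open>y\<close>, \<open>z\<close> in \<open>{1} \<times> \<real>\<^sup>k\<close>. Here
  \<open>|y|\<^sup>2 = 1 + d(e,y)\<^sup>2\<close>, and \<open>r\<close> is an elliptic rational iff \<open>r\<close> and \<open>sqrt (1 + r\<^sup>2)\<close> are
  rational, so elliptic distances to \<open>e\<close> make all \<open>|y|\<close> rational and hence all distances on the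
  sphere rational. The distance \<open>r\<close> to \<open>e\<close> corresponds to \<open>2 h\<close> with \<open>h = r / sqrt (1 + r\<^sup>2)\<close>, and
  \<open>h \<le> 1\<close> is a hyperbolic rational iff \<open>h\<close> and \<open>sqrt (1 - h\<^sup>2)\<close> are rational, which gives the
  converse. A similarity of \<open>\<real>\<^sup>k\<close>, respectively a reflection of the sphere, moves the
  base point of a given rational set to \<open>e\<close>.
\<close>

subsection \<open>Elliptic and hyperbolic rationals\<close>

text \<open>A rational root of a monic polynomial over the integers is an integer: with p/q in
  lowest terms, q^2 divides p^2 and is coprime to it. This turns rational square roots into the
  integers m that the two definitions ask for.\<close>

lemma Rats_power2_Ints_imp_Ints:
  fixes x :: real
  assumes "x \<in> \<rat>" "x\<^sup>2 \<in> \<int>"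
  shows "x \<in> \<int>"
proof -
  obtain p q where pq: "q > 0" "coprime p q" "x = of_int p / of_int q"
    using assms(1) by (rule Rats_cases')
  obtain n where n: "x\<^sup>2 = of_int n"
    using assms(2) by (rule Ints_cases)
  have "real_of_int (p\<^sup>2) = of_int (n * q\<^sup>2)"
    using n pq by (simp add: power_divide field_simps)
  then have "p\<^sup>2 = n * q\<^sup>2"
    by (simp only: of_int_eq_iff)
  then have "q\<^sup>2 dvd p\<^sup>2" by simp
  moreover have "coprime (p\<^sup>2) (q\<^sup>2)" using pq by simp
  ultimately have "is_unit (q\<^sup>2)"
    using coprime_common_divisor dvd_refl by blast
  then have "is_unit q" by (simp only: is_unit_power_iff) simp
  then have "q = 1" using pq(1) by simp
  then show ?thesis using pq by simp
qed

text \<open>With r = p/q in lowest terms, sqrt (1 + r^2) is the square root of p^2 + q^2 divided by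
  q. The criterion is free of the reduced fraction, so it can be checked on sums and quotients
  directly.\<close>

lemma elliptic_iff:
  "r \<in> pos_elliptic_rationals \<union> {0} \<longleftrightarrow> r \<ge> 0 \<and> r \<in> \<rat> \<and> sqrt (1 + r\<^sup>2) \<in> \<rat>"
proof
  assume L: "r \<in> pos_elliptic_rationals \<union> {0}"
  show "r \<ge> 0 \<and> r \<in> \<rat> \<and> sqrt (1 + r\<^sup>2) \<in> \<rat>"
  proof (cases "r = 0")
    case False
    with L obtain p q m :: int where pq: "r > 0" "q > 0" "r = of_int p / of_int q" "p\<^sup>2 + q\<^sup>2 = m\<^sup>2"
      unfolding pos_elliptic_rationals_def by blast
    have "(of_int p)\<^sup>2 + (of_int q)\<^sup>2 = (of_int m :: real)\<^sup>2"
      using pq(4) by (metis of_int_add of_int_power)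
    then have "1 + r\<^sup>2 = (of_int m / of_int q)\<^sup>2"
      unfolding pq(3) power_divide using pq(2) by (simp add: divide_simps add.commute)
    then have "sqrt (1 + r\<^sup>2) = \<bar>of_int m / of_int q\<bar>"
      by simp
    then show ?thesis using pq by simp
  qed simp
next
  assume R: "r \<ge> 0 \<and> r \<in> \<rat> \<and> sqrt (1 + r\<^sup>2) \<in> \<rat>"
  show "r \<in> pos_elliptic_rationals \<union> {0}"
  proof (cases "r = 0")
    case False
    have "r \<in> \<rat>" using R by blast
    then obtain p q where pq: "q > 0" "coprime p q" "r = of_int p / of_int q"
      by (rule Rats_cases')
    \<comment> \<open>\<open>s\<close> is the candidate for m: it is rational and its square is the
      integer p^2 + q^2.\<close>
    define s where "s = of_int q * sqrt (1 + r\<^sup>2)"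
    have "s\<^sup>2 = (of_int q)\<^sup>2 * (1 + r\<^sup>2)"
      by (simp add: s_def power_mult_distrib)
    also have "\<dots> = (of_int q)\<^sup>2 + (of_int q * r)\<^sup>2" by algebra
    also have "of_int q * r = of_int p" using pq by simp
    finally have s2: "s\<^sup>2 = of_int (p\<^sup>2 + q\<^sup>2)" by simp
    have "s \<in> \<int>"
    proof (rule Rats_power2_Ints_imp_Ints)
      show "s \<in> \<rat>" unfolding s_def using R by (intro Rats_mult) auto
      show "s\<^sup>2 \<in> \<int>" unfolding s2 by (rule Ints_of_int)
    qed
    then obtain m where "s = of_int m" by (rule Ints_cases)
    with s2 have "real_of_int (p\<^sup>2 + q\<^sup>2) = of_int (m\<^sup>2)" by simp
    then have "p\<^sup>2 + q\<^sup>2 = m\<^sup>2" by (simp only: of_int_eq_iff)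
    moreover have "r > 0" using False R by simp
    ultimately show ?thesis using pq unfolding pos_elliptic_rationals_def by blast
  qed simp
qed

text \<open>The bound on h gives p <= q, so both signs in the definition lead to q^2 - p^2 = m^2.
  From there the argument is that of \<open>elliptic_iff\<close>. Half the distance between two
  points of the unit sphere satisfies the bound.\<close>

lemma hyperbolic_iff:
  assumes "h \<le> 1"
  shows "h \<in> pos_hyperbolic_rationals \<union> {0} \<longleftrightarrow> h \<ge> 0 \<and> h \<in> \<rat> \<and> sqrt (1 - h\<^sup>2) \<in> \<rat>"
proof
  assume L: "h \<in> pos_hyperbolic_rationals \<union> {0}"
  show "h \<ge> 0 \<and> h \<in> \<rat> \<and> sqrt (1 - h\<^sup>2) \<in> \<rat>"
  proof (cases "h = 0")
    case False
    with L obtain p q m :: int where pq: "h > 0" "q > 0" "h = of_int p / of_int q"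
      "p\<^sup>2 - q\<^sup>2 = m\<^sup>2 \<or> p\<^sup>2 - q\<^sup>2 = - (m\<^sup>2)"
      unfolding pos_hyperbolic_rationals_def by blast
    have "p > 0" using pq by (simp add: zero_less_divide_iff)
    moreover have "p \<le> q" using pq(2,3) assms by simp
    ultimately have "p\<^sup>2 \<le> q\<^sup>2" by (intro power_mono) auto
    then have "q\<^sup>2 - p\<^sup>2 = m\<^sup>2" using pq(4) zero_le_power2[of m] by linarith
    then have "(of_int q)\<^sup>2 - (of_int p)\<^sup>2 = (of_int m :: real)\<^sup>2"
      by (metis of_int_diff of_int_power)
    then have "1 - h\<^sup>2 = (of_int m / of_int q)\<^sup>2"
      unfolding pq(3) power_divide using pq(2) by (simp add: divide_simps)
    then have "sqrt (1 - h\<^sup>2) = \<bar>of_int m / of_int q\<bar>"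
      by simp
    then show ?thesis using pq by simp
  qed simp
next
  assume R: "h \<ge> 0 \<and> h \<in> \<rat> \<and> sqrt (1 - h\<^sup>2) \<in> \<rat>"
  show "h \<in> pos_hyperbolic_rationals \<union> {0}"
  proof (cases "h = 0")
    case False
    have "h \<in> \<rat>" using R by blast
    then obtain p q where pq: "q > 0" "coprime p q" "h = of_int p / of_int q"
      by (rule Rats_cases')
    define s where "s = of_int q * sqrt (1 - h\<^sup>2)"
    have "h\<^sup>2 \<le> 1" using R assms by (simp add: power_le_one)
    then have "s\<^sup>2 = (of_int q)\<^sup>2 * (1 - h\<^sup>2)"
      by (simp add: s_def power_mult_distrib)
    also have "\<dots> = (of_int q)\<^sup>2 - (of_int q * h)\<^sup>2" by algebra
    also have "of_int q * h = of_int p" using pq by simp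
    finally have s2: "s\<^sup>2 = of_int (q\<^sup>2 - p\<^sup>2)" by simp
    have "s \<in> \<int>"
    proof (rule Rats_power2_Ints_imp_Ints)
      show "s \<in> \<rat>" unfolding s_def using R by (intro Rats_mult) auto
      show "s\<^sup>2 \<in> \<int>" unfolding s2 by (rule Ints_of_int)
    qed
    then obtain m where "s = of_int m" by (rule Ints_cases)
    with s2 have "real_of_int (q\<^sup>2 - p\<^sup>2) = of_int (m\<^sup>2)" by simp
    then have "q\<^sup>2 - p\<^sup>2 = m\<^sup>2" by (simp only: of_int_eq_iff)
    then have "p\<^sup>2 - q\<^sup>2 = - (m\<^sup>2)" by simp
    moreover have "h > 0" using False R by simp
    ultimately show ?thesis using pq unfolding pos_hyperbolic_rationals_def by blast
  qed simp
qed

subsection \<open>Euclidean geometry of coordinate sequences\<close>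

lemma einner_commute: "einner n x y = einner n y x"
  by (simp add: einner_def mult.commute)

lemma einner_self_nonneg: "0 \<le> einner n x x"
  by (simp add: einner_def sum_nonneg)

lemma einner_lincomb:
  "einner n (\<lambda>i. a * x i + b * y i) z = a * einner n x z + b * einner n y z"
  by (simp add: einner_def algebra_simps sum.distrib sum_distrib_left)

lemma einner_lincomb_both:
  "einner n (\<lambda>i. a * x i + b * y i) (\<lambda>i. c * z i + d * w i) =
    a * c * einner n x z + a * d * einner n x w + b * c * einner n y z + b * d * einner n y w"
  by (simp add: einner_def algebra_simps sum.distrib sum_distrib_left)

lemma einner_e0_left [simp]: "einner (Suc k) e0 x = x 0"
  by (simp add: einner_def e0_def sum.lessThan_Suc_shift del: sum.lessThan_Suc)

lemma einner_e0_right [simp]: "einner (Suc k) x e0 = x 0"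
  using einner_commute einner_e0_left by metis

lemma e0_0 [simp]: "e0 0 = 1"
  by (simp add: e0_def)

lemma enorm_eq_sqrt: "enorm n x = sqrt (einner n x x)"
  by (simp add: enorm_def einner_def L2_set_def power2_eq_square)

lemma edist_nonneg: "0 \<le> edist n x y"
  by (simp add: edist_def)

lemma edist_power2: "(edist n x y)\<^sup>2 = einner n x x - 2 * einner n x y + einner n y y"
proof -
  have "(edist n x y)\<^sup>2 = (\<Sum>i<n. (x i - y i)\<^sup>2)"
    by (simp add: edist_def L2_set_def sum_nonneg)
  also have "\<dots> = einner n x x - 2 * einner n x y + einner n y y"
    by (simp add: einner_def power2_diff sum.distrib sum_subtractf sum_distrib_left mult.assoc)
      (simp add: power2_eq_square)
  finally show ?thesis .
qed

text \<open>Cauchy-Schwarz for unit vectors, read off from |x + c y|^2 >= 0 at c = 1 and c =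
  -1.\<close>

lemma abs_einner_unit_le_1:
  assumes "einner n x x = 1" "einner n y y = 1"
  shows "\<bar>einner n x y\<bar> \<le> 1"
proof -
  have "0 \<le> einner n (\<lambda>i. 1 * x i + c * y i) (\<lambda>i. 1 * x i + c * y i)" for c
    by (rule einner_self_nonneg)
  then have "0 \<le> 1 + 2 * c * einner n x y + c * c" for c
    using assms by (simp only: einner_lincomb_both) (simp add: einner_commute algebra_simps)
  from this[of 1] this[of "-1"] show ?thesis by auto
qed

section \<open>The sphere, the punctured sphere and the tangent hyperplane\<close>

lemma topspace_nsphere:
  "topspace (nsphere k) = {x. (\<forall>i>k. x i = 0) \<and> einner (Suc k) x x = 1}"
  by (auto simp: nsphere einner_def power2_eq_square lessThan_Suc_atMost)

lemma topspace_punctured_sphere: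
  "topspace (punctured_sphere k) = topspace (nsphere k) - {neg_e0}"
  by (auto simp: punctured_sphere_def)

lemma topspace_tangent_space:
  "topspace (tangent_space k) = {x. (\<forall>i>k. x i = 0) \<and> x 0 = 1}"
  by (auto simp: tangent_space_def topspace_Euclidean_space Suc_le_eq)

lemma e0_in_nsphere: "e0 \<in> topspace (nsphere k)"
  by (simp add: topspace_nsphere) (simp add: e0_def)

lemma e0_neq_neg_e0: "e0 \<noteq> neg_e0"
proof
  assume "e0 = neg_e0"
  then have "e0 0 = neg_e0 0" by simp
  then show False by (simp add: neg_e0_def)
qed

lemma e0_in_punctured_sphere: "e0 \<in> topspace (punctured_sphere k)"
  by (simp add: topspace_punctured_sphere e0_in_nsphere e0_neq_neg_e0)

lemma e0_in_tangent_space: "e0 \<in> topspace (tangent_space k)"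
  by (simp add: topspace_tangent_space) (simp add: e0_def)

lemma abs_nsphere_0_le_1:
  assumes "P \<in> topspace (nsphere k)"
  shows "\<bar>P 0\<bar> \<le> 1"
  using abs_einner_unit_le_1[of "Suc k" P e0] assms by (simp add: topspace_nsphere)

text \<open>Coordinate 0 already accounts for the whole norm, so the squares of the other
  coordinates sum to 0.\<close>

lemma nsphere_0_sq_eq_1:
  assumes "P \<in> topspace (nsphere k)" and "(P 0)\<^sup>2 = 1"
  shows "P = (\<lambda>i. P 0 * e0 i)"
proof
  fix i
  have tail: "\<forall>i>k. P i = 0" and "(\<Sum>i<Suc k. P i * P i) = 1"
    using assms(1) by (auto simp: topspace_nsphere einner_def)
  then have "(\<Sum>i<k. P (Suc i) * P (Suc i)) = 0"
    using assms(2) unfolding sum.lessThan_Suc_shift by (simp add: power2_eq_square)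
  then have "\<forall>i<k. P (Suc i) = 0"
    by (simp add: sum_nonneg_eq_0_iff)
  with tail show "P i = P 0 * e0 i"
    by (cases i; cases "i - 1 < k") (auto simp: e0_def)
qed

lemma nsphere_0_eq_1_iff:
  assumes "P \<in> topspace (nsphere k)"
  shows "P 0 = 1 \<longleftrightarrow> P = e0"
  using nsphere_0_sq_eq_1[OF assms] by auto

lemma nsphere_0_eq_minus_1_iff:
  assumes "P \<in> topspace (nsphere k)"
  shows "P 0 = -1 \<longleftrightarrow> P = neg_e0"
  using nsphere_0_sq_eq_1[OF assms] by (auto simp: neg_e0_def)

text \<open>Removing -e is what keeps the denominator 1 + P_0 of the projection positive.\<close>

lemma punctured_sphere_0_gt:
  assumes "P \<in> topspace (punctured_sphere k)"
  shows "-1 < P 0"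
  using assms abs_nsphere_0_le_1[of P k] nsphere_0_eq_minus_1_iff[of P k]
  by (force simp: topspace_punctured_sphere)

subsection \<open>The bisector projection in coordinates\<close>

text \<open>The sum of two unit vectors bisects their angle, and |e + P|^2 = 2 + 2 P_0. Existence is
  the half-angle formula. For uniqueness, the two angle conditions become linear equations for the
  coefficients \<open>a\<close> and \<open>b\<close>.\<close>

lemma unit_bisector_eq:
  assumes "P \<in> topspace (punctured_sphere k)"
  shows "unit_bisector k P = (\<lambda>i. (e0 i + P i) / sqrt (2 + 2 * P 0))"
proof (cases "P = e0")
  case True
  have "(\<lambda>i. (e0 i + e0 i) / sqrt (2 + 2 * e0 0)) = e0"
  proof
    show "(e0 i + e0 i) / sqrt (2 + 2 * e0 0) = e0 i" for i
      using real_sqrt_abs[of 2] by simp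
  qed
  with True show ?thesis by (simp add: unit_bisector_def)
next
  case False
  have PS: "P \<in> topspace (nsphere k)" using assms by (simp add: topspace_punctured_sphere)
  then have PP: "einner (Suc k) P P = 1" by (simp add: topspace_nsphere)
  have c: "-1 < P 0" "P 0 < 1"
    using punctured_sphere_0_gt[OF assms] abs_nsphere_0_le_1[OF PS] nsphere_0_eq_1_iff[OF PS] False
    by (auto simp: less_le)
  define \<theta> where "\<theta> = arccos (P 0)"
  define C where "C = cos (\<theta> / 2)"
  have th: "0 \<le> \<theta>" "\<theta> \<le> pi" "cos \<theta> = P 0"
    using c by (auto simp: \<theta>_def arccos_lbound arccos_ubound)
  \<comment> \<open>The double-angle formula identifies the cosine \<open>C\<close> of the half
    angle with |e + P| / 2.\<close>
  have "cos \<theta> = 2 * C\<^sup>2 - 1"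
    unfolding C_def using cos_double_cos[of "\<theta> / 2"] by simp
  then have C2: "C\<^sup>2 = (1 + P 0) / 2" using th by simp
  have "C \<ge> 0" unfolding C_def using th by (intro cos_ge_zero) auto
  have C: "C = sqrt (2 + 2 * P 0) / 2"
  proof (rule power2_eq_imp_eq)
    show "C\<^sup>2 = (sqrt (2 + 2 * P 0) / 2)\<^sup>2"
      using c by (simp add: C2 power_divide field_simps)
  qed (use c \<open>C \<ge> 0\<close> in auto)
  have \<theta>: "eangle (Suc k) e0 P = \<theta>"
    by (simp add: eangle_def enorm_eq_sqrt PP \<theta>_def)
  let ?V = "\<lambda>i. (e0 i + P i) / sqrt (2 + 2 * P 0)"
  let ?s = "1 / sqrt (2 + 2 * P 0)"
  have V: "?V = (\<lambda>i. ?s * e0 i + ?s * P i)"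
    by (simp add: fun_eq_iff add_divide_distrib)
  have ss: "?s * ?s * (2 + 2 * P 0) = 1" using c by simp
  have VV: "einner (Suc k) ?V ?V = 1"
    unfolding V einner_lincomb_both einner_e0_left einner_e0_right PP e0_0 using ss by algebra
  have sC: "?s * (1 + P 0) = C"
    unfolding C using c by (simp add: field_simps)
  have Ve: "einner (Suc k) e0 ?V = C"
    using sC by (simp add: algebra_simps)
  have VP: "einner (Suc k) ?V P = C"
    unfolding V einner_lincomb einner_e0_left PP using sC by (simp only: distrib_left add.commute)
  have arcC: "arccos C = \<theta> / 2"
    unfolding C_def using th by (intro arccos_cos) auto
  have "is_unit_bisector k P ?V"
    unfolding is_unit_bisector_def
  proof (intro conjI)
    show "\<exists>a b. ?V = (\<lambda>i. a * e0 i + b * P i)" using V by blast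
    show "enorm (Suc k) ?V = 1" using VV by (simp add: enorm_eq_sqrt)
    show "eangle (Suc k) e0 ?V = eangle (Suc k) e0 P / 2"
      unfolding \<theta> unfolding eangle_def enorm_eq_sqrt VV Ve using arcC by simp
    show "eangle (Suc k) ?V P = eangle (Suc k) e0 P / 2"
      unfolding \<theta> unfolding eangle_def enorm_eq_sqrt VV VP PP using arcC by simp
  qed
  moreover have "U = ?V" if "is_unit_bisector k P U" for U
  proof -
    obtain a b where U: "U = (\<lambda>i. a * e0 i + b * P i)" and n: "enorm (Suc k) U = 1"
      and a1: "eangle (Suc k) e0 U = \<theta> / 2" and a2: "eangle (Suc k) U P = \<theta> / 2"
      using \<open>is_unit_bisector k P U\<close> \<theta> unfolding is_unit_bisector_def by auto
    have UU: "einner (Suc k) U U = 1"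
      using n by (simp add: enorm_eq_sqrt)
    \<comment> \<open>On [-1, 1] the cosine undoes arccos, so an angle condition fixes the
      corresponding inner product.\<close>
    have "\<bar>U 0\<bar> \<le> 1" using abs_einner_unit_le_1[OF UU, of e0] by simp
    moreover have "arccos (U 0) = \<theta> / 2"
      using a1 by (simp add: eangle_def enorm_eq_sqrt UU)
    ultimately have "U 0 = C"
      unfolding C_def by (metis cos_arccos_abs)
    then have e1: "a + b * P 0 = C" by (simp add: U)
    have "\<bar>einner (Suc k) U P\<bar> \<le> 1" using abs_einner_unit_le_1[OF UU PP] .
    moreover have "arccos (einner (Suc k) U P) = \<theta> / 2"
      using a2 by (simp add: eangle_def enorm_eq_sqrt UU PP)
    ultimately have "einner (Suc k) U P = C"
      unfolding C_def by (metis cos_arccos_abs)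
    then have e2: "a * P 0 + b = C"
      unfolding U einner_lincomb using PP by simp
    \<comment> \<open>Difference of the two linear equations; the factor 1 - P_0 is nonzero because
      P differs from e.\<close>
    have "(a - b) * (1 - P 0) = 0" using e1 e2 by (simp add: algebra_simps)
    then have ab: "a = b" using c by simp
    have "a * (1 + P 0) = C" using e1 unfolding ab by (simp only: distrib_left mult_1_right)
    then have "a * (1 + P 0) = ?s * (1 + P 0)" unfolding sC .
    moreover have "1 + P 0 \<noteq> 0" using c by simp
    ultimately have "a = ?s" by (rule mult_right_cancel[THEN iffD1, rotated])
    then show ?thesis unfolding V U using ab by simp
  qed
  ultimately have "(THE U. is_unit_bisector k P U) = ?V" by (rule the_equality)
  then show ?thesis using False by (simp add: unit_bisector_def)
qed

text \<open>Coordinate 0 of the bisector is (1 + P_0) / |e + P|, so the ray meets the hyperplane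
  exactly at the parameter t = |e + P| / (1 + P_0).\<close>

lemma phi_eq:
  assumes "P \<in> topspace (punctured_sphere k)"
  shows "phi k P = (\<lambda>i. (e0 i + P i) / (1 + P 0))"
proof -
  let ?s = "sqrt (2 + 2 * P 0)"
  have c: "-1 < P 0" using punctured_sphere_0_gt[OF assms] .
  then have s: "?s > 0" "?s * ?s = 2 * (1 + P 0)" by auto
  have PS: "\<forall>i>k. P i = 0" using assms by (simp add: topspace_punctured_sphere topspace_nsphere)
  note ub = unit_bisector_eq[OF assms]
  show ?thesis
    unfolding phi_def
  proof (rule the_equality)
    have "(\<lambda>i. (e0 i + P i) / (1 + P 0)) \<in> topspace (tangent_space k)"
      using PS c by (auto simp: topspace_tangent_space e0_def)
    moreover have "(\<lambda>i. (e0 i + P i) / (1 + P 0)) = (\<lambda>i. ?s / (1 + P 0) * unit_bisector k P i)"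
      unfolding ub using s c by (simp add: fun_eq_iff)
    moreover have "?s / (1 + P 0) \<ge> 0" using s c by simp
    ultimately show "(\<lambda>i. (e0 i + P i) / (1 + P 0)) \<in> topspace (tangent_space k) \<and>
        (\<exists>t\<ge>0. (\<lambda>i. (e0 i + P i) / (1 + P 0)) = (\<lambda>i. t * unit_bisector k P i))"
      by blast
  next
    fix Q assume "Q \<in> topspace (tangent_space k) \<and> (\<exists>t\<ge>0. Q = (\<lambda>i. t * unit_bisector k P i))"
    then obtain t where Q: "Q 0 = 1" "Q = (\<lambda>i. t * unit_bisector k P i)"
      by (auto simp: topspace_tangent_space)
    have "Q 0 = t * unit_bisector k P 0" using Q(2) by (rule fun_cong)
    then have "t * ((1 + P 0) / ?s) = 1" unfolding Q(1) ub e0_0 by (rule sym)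
    then have t: "t = ?s / (1 + P 0)" using s c by (simp add: field_simps)
    then show "Q = (\<lambda>i. (e0 i + P i) / (1 + P 0))"
      unfolding Q(2) ub t using s by (simp add: fun_eq_iff)
  qed
qed

lemma phi_e0: "phi k e0 = e0"
  by (simp add: phi_eq[OF e0_in_punctured_sphere])

section \<open>The inverse projection and its distance formula\<close>

text \<open>Written, like the reflection below, as a linear combination so that \<open>einner_lincomb_both\<close> applies.\<close>

definition phi_inv :: "nat \<Rightarrow> (nat \<Rightarrow> real) \<Rightarrow> nat \<Rightarrow> real" where
  "phi_inv k y = (\<lambda>i. 2 / einner (Suc k) y y * y i + -1 * e0 i)"

text \<open>Pythagoras, since y - e is orthogonal to e. It ties the ellipticity of the distance to e
  to the rationality of |y|.\<close>

lemma einner_tangent_eq: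
  assumes "y \<in> topspace (tangent_space k)"
  shows "einner (Suc k) y y = 1 + (edist (Suc k) e0 y)\<^sup>2"
  using assms by (simp add: edist_power2 topspace_tangent_space)

lemma einner_tangent_pos:
  assumes "y \<in> topspace (tangent_space k)"
  shows "0 < einner (Suc k) y y"
  unfolding einner_tangent_eq[OF assms] by (simp add: add_pos_nonneg)

lemma einner_phi_inv:
  assumes "y \<in> topspace (tangent_space k)" "z \<in> topspace (tangent_space k)"
  shows "einner (Suc k) (phi_inv k y) (phi_inv k z) =
    4 * einner (Suc k) y z / (einner (Suc k) y y * einner (Suc k) z z)
      - 2 / einner (Suc k) y y - 2 / einner (Suc k) z z + 1"
  using assms unfolding phi_inv_def einner_lincomb_both by (simp add: topspace_tangent_space)

text \<open>As y_0 = 1, the point \<open>phi_inv k y\<close> is the mirror image of e in the line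
  through O and y. So it is a unit vector, and its coordinate 0 is 2 / |y|^2 - 1 > -1.\<close>

lemma phi_inv_in_punctured_sphere:
  assumes "y \<in> topspace (tangent_space k)"
  shows "phi_inv k y \<in> topspace (punctured_sphere k)"
proof -
  have "einner (Suc k) (phi_inv k y) (phi_inv k y) = 1"
    using einner_tangent_pos[OF assms] by (simp add: einner_phi_inv assms)
  then have "phi_inv k y \<in> topspace (nsphere k)"
    using assms by (simp add: topspace_nsphere topspace_tangent_space)
      (simp add: phi_inv_def e0_def)
  moreover have "phi_inv k y 0 \<noteq> -1"
    using einner_tangent_pos[OF assms] assms by (simp add: phi_inv_def topspace_tangent_space)
  ultimately show ?thesis
    using nsphere_0_eq_minus_1_iff by (auto simp: topspace_punctured_sphere)
qed

lemma phi_phi_inv: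
  assumes "y \<in> topspace (tangent_space k)"
  shows "phi k (phi_inv k y) = y"
  unfolding phi_eq[OF phi_inv_in_punctured_sphere[OF assms]]
  using einner_tangent_pos[OF assms] assms
  by (simp add: fun_eq_iff phi_inv_def topspace_tangent_space)

lemma phi_in_tangent_space:
  assumes "P \<in> topspace (punctured_sphere k)"
  shows "phi k P \<in> topspace (tangent_space k)"
  using assms punctured_sphere_0_gt[OF assms]
  by (auto simp: phi_eq topspace_tangent_space topspace_punctured_sphere topspace_nsphere e0_def)

text \<open>This value is the reciprocal of the squared cosine of half the angle AOP.\<close>

lemma einner_phi:
  assumes "P \<in> topspace (punctured_sphere k)"
  shows "einner (Suc k) (phi k P) (phi k P) = 2 / (1 + P 0)"
proof -
  have c: "-1 < P 0" using punctured_sphere_0_gt[OF assms] .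
  have PP: "einner (Suc k) P P = 1"
    using assms by (simp add: topspace_punctured_sphere topspace_nsphere)
  let ?s = "1 / (1 + P 0)"
  have "phi k P = (\<lambda>i. ?s * e0 i + ?s * P i)"
    by (simp add: phi_eq[OF assms] fun_eq_iff add_divide_distrib)
  then have "einner (Suc k) (phi k P) (phi k P) = ?s * ?s + ?s * ?s * P 0 + ?s * ?s * P 0 + ?s * ?s"
    by (simp only: einner_lincomb_both einner_e0_left einner_e0_right PP e0_0 mult_1_right)
  also have "\<dots> = ?s * ?s * (2 + 2 * P 0)" by algebra
  also have "\<dots> = 2 / (1 + P 0)" using c by (simp add: divide_simps)
  finally show ?thesis .
qed

lemma phi_inv_phi:
  assumes "P \<in> topspace (punctured_sphere k)"
  shows "phi_inv k (phi k P) = P"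
  using punctured_sphere_0_gt[OF assms]
  unfolding phi_inv_def einner_phi[OF assms] by (simp add: fun_eq_iff phi_eq[OF assms])

text \<open>Up to the translation by -e, \<open>phi_inv\<close> is inversion in the sphere of radius
  sqrt 2 about O, and this is the classical distance formula for inversions. It is verified by
  comparing squares.\<close>

lemma edist_phi_inv:
  assumes "y \<in> topspace (tangent_space k)" "z \<in> topspace (tangent_space k)"
  shows "edist (Suc k) (phi_inv k y) (phi_inv k z) =
    2 * edist (Suc k) y z / (sqrt (einner (Suc k) y y) * sqrt (einner (Suc k) z z))"
proof (rule power2_eq_imp_eq)
  note pos = assms[THEN einner_tangent_pos]
  have "(edist (Suc k) (phi_inv k y) (phi_inv k z))\<^sup>2 =
      4 / einner (Suc k) y y + 4 / einner (Suc k) z z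
        - 8 * einner (Suc k) y z / (einner (Suc k) y y * einner (Suc k) z z)"
    using pos by (simp add: edist_power2 einner_phi_inv assms)
  also have "\<dots> = 4 * (edist (Suc k) y z)\<^sup>2 / (einner (Suc k) y y * einner (Suc k) z z)"
    using pos by (simp add: edist_power2 field_simps)
  finally show "(edist (Suc k) (phi_inv k y) (phi_inv k z))\<^sup>2 =
      (2 * edist (Suc k) y z / (sqrt (einner (Suc k) y y) * sqrt (einner (Suc k) z z)))\<^sup>2"
    using pos by (simp add: power_divide power_mult_distrib)
qed (simp_all add: edist_nonneg einner_self_nonneg)

lemma phi_inv_e0: "phi_inv k e0 = e0"
  using phi_inv_phi[OF e0_in_punctured_sphere] by (simp add: phi_e0)

lemma edist_e0_phi_inv:
  assumes "y \<in> topspace (tangent_space k)"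
  shows "edist (Suc k) e0 (phi_inv k y) = 2 * (edist (Suc k) e0 y / sqrt (einner (Suc k) y y))"
  using edist_phi_inv[OF e0_in_tangent_space assms] by (simp add: phi_inv_e0)

lemma phi_preimage:
  assumes "Y \<subseteq> topspace (tangent_space k)"
  shows "{P \<in> topspace (punctured_sphere k). phi k P \<in> Y} = phi_inv k ` Y"
proof
  show "{P \<in> topspace (punctured_sphere k). phi k P \<in> Y} \<subseteq> phi_inv k ` Y"
    using phi_inv_phi by (metis (no_types, lifting) image_eqI mem_Collect_eq subsetI)
  show "phi_inv k ` Y \<subseteq> {P \<in> topspace (punctured_sphere k). phi k P \<in> Y}"
    using assms phi_inv_in_punctured_sphere phi_phi_inv by auto
qed

subsection \<open>Topology\<close>

text \<open>All spaces involved are subspaces of the countable product of real lines, so continuity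
  reduces to coordinates and a range condition. The equations below present each space in this
  form.\<close>

lemma continuous_map_subtopology_powertop:
  assumes "\<And>i. continuous_map X euclideanreal (\<lambda>x. f x i)" "f \<in> topspace X \<rightarrow> T"
  shows "continuous_map X (subtopology (powertop_real UNIV) T) f"
  using assms by (simp add: continuous_map_in_subtopology continuous_map_componentwise_UNIV)

lemma continuous_map_coordinate:
  "continuous_map (subtopology (powertop_real UNIV) S) euclideanreal (\<lambda>x. x i)"
  by (intro continuous_map_from_subtopology continuous_map_product_projection) simp

lemma nsphere_eq: "nsphere k = subtopology (powertop_real UNIV) (topspace (nsphere k))"
  by (simp add: nsphere)

lemma punctured_sphere_eq:
  "punctured_sphere k = subtopology (powertop_real UNIV) (topspace (punctured_sphere k))"
  by (simp add: punctured_sphere_def nsphere subtopology_subtopology)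

lemma Euclidean_space_eq:
  "Euclidean_space k = subtopology (powertop_real UNIV) (topspace (Euclidean_space k))"
  by (simp add: Euclidean_space_def)

lemma tangent_space_eq:
  "tangent_space k = subtopology (powertop_real UNIV) (topspace (tangent_space k))"
  by (simp add: tangent_space_def Euclidean_space_def subtopology_subtopology)

lemma homeomorphic_maps_phi:
  "homeomorphic_maps (punctured_sphere k) (tangent_space k) (phi k) (phi_inv k)"
  unfolding homeomorphic_maps_def
proof (intro conjI ballI)
  have "continuous_map (punctured_sphere k) (tangent_space k) (\<lambda>P i. (e0 i + P i) / (1 + P 0))"
  proof (subst tangent_space_eq, rule continuous_map_subtopology_powertop)
    have cont: "continuous_map (punctured_sphere k) euclideanreal (\<lambda>P. P i)" for i
      by (subst punctured_sphere_eq) (rule continuous_map_coordinate)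
    show "continuous_map (punctured_sphere k) euclideanreal (\<lambda>P. (e0 i + P i) / (1 + P 0))" for i
      using punctured_sphere_0_gt by (intro continuous_intros cont) force+
    show "(\<lambda>P i. (e0 i + P i) / (1 + P 0)) \<in> topspace (punctured_sphere k) \<rightarrow> topspace (tangent_space k)"
      using phi_in_tangent_space phi_eq by (metis (no_types, lifting) Pi_I)
  qed
  then show "continuous_map (punctured_sphere k) (tangent_space k) (phi k)"
    by (rule continuous_map_eq) (simp add: phi_eq)
  show "continuous_map (tangent_space k) (punctured_sphere k) (phi_inv k)"
  proof (subst punctured_sphere_eq, rule continuous_map_subtopology_powertop)
    have cont: "continuous_map (tangent_space k) euclideanreal (\<lambda>P. P i)" for i
      by (subst tangent_space_eq) (rule continuous_map_coordinate)
    show "continuous_map (tangent_space k) euclideanreal (\<lambda>y. phi_inv k y i)" for i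
      unfolding phi_inv_def
      using einner_tangent_pos unfolding einner_def by (intro continuous_intros cont) force+
  qed (simp add: phi_inv_in_punctured_sphere)
qed (simp_all add: phi_inv_phi phi_phi_inv)

lemma dense_in_continuous_image:
  assumes "continuous_map S T f" "f ` topspace S = topspace T" "dense_in S X"
  shows "dense_in T (f ` X)"
  using assms continuous_map_image_closure_subset[OF assms(1), of X] closure_of_subset_topspace[of T]
  unfolding dense_in_def by blast

lemma dense_in_homeomorphic_maps:
  assumes "homeomorphic_maps S T f g" "dense_in S X"
  shows "dense_in T (f ` X)"
  using dense_in_continuous_image assms homeomorphic_maps_map homeomorphic_eq_everything_map by metis

text \<open>An open U satisfies U \<inter> cl X \<subseteq> cl (U \<inter> X), so density passes to
  open subspaces.\<close>

lemma dense_in_openin: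
  assumes "openin T U" "dense_in T X"
  shows "dense_in (subtopology T U) (U \<inter> X)"
proof -
  have "U \<inter> T closure_of (U \<inter> X) = U"
    using openin_Int_closure_of_eq[OF assms(1), of X] assms openin_subset
    unfolding dense_in_def by (smt (verit) Int_absorb1 Int_commute inf.absorb_iff1
        openin_Int_closure_of_subset)
  then show ?thesis
    using assms openin_subset[OF assms(1)] unfolding dense_in_def
    by (auto simp: closure_of_subtopology)
qed

text \<open>Only -e has to be approximated, by points of a great circle through it. For k = 0 the
  sphere is {e, -e} and -e is isolated.\<close>

lemma punctured_sphere_dense:
  assumes "k > 0"
  shows "dense_in (nsphere k) (topspace (punctured_sphere k))"
proof -
  \<comment> \<open>Rational parametrisation of the unit circle in coordinates 0 and 1, chosen to
    pass through -e at t = 0.\<close>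
  define c :: "real \<Rightarrow> nat \<Rightarrow> real"
    where "c t = (\<lambda>i. if i = 0 then (t\<^sup>2 - 1) / (1 + t\<^sup>2) else if i = 1 then 2 * t / (1 + t\<^sup>2) else 0)" for t
  have pos: "1 + t\<^sup>2 > 0" for t :: real by (simp add: add_pos_nonneg)
  have c_sphere: "c t \<in> topspace (nsphere k)" for t
  proof -
    obtain l where "k = Suc l" using assms gr0_implies_Suc by blast
    then have "einner (Suc k) (c t) (c t) = c t 0 * c t 0 + c t 1 * c t 1"
      by (simp add: einner_def sum.lessThan_Suc_shift c_def del: sum.lessThan_Suc)
    also have "\<dots> = ((t\<^sup>2 - 1)\<^sup>2 + (2 * t)\<^sup>2) / (1 + t\<^sup>2)\<^sup>2"
      by (simp add: c_def power2_eq_square add_divide_distrib)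
    also have "(t\<^sup>2 - 1)\<^sup>2 + (2 * t)\<^sup>2 = (1 + t\<^sup>2)\<^sup>2" by algebra
    finally have "einner (Suc k) (c t) (c t) = 1" using pos[of t] by simp
    then show ?thesis using assms by (simp add: topspace_nsphere c_def)
  qed
  have "continuous_map euclideanreal (nsphere k) c"
  proof (subst nsphere_eq, rule continuous_map_subtopology_powertop)
    show "continuous_map euclideanreal euclideanreal (\<lambda>t. c t i)" for i
    proof -
      have nonzero: "1 + t\<^sup>2 \<noteq> 0" for t :: real using pos[of t] by simp
      consider "i = 0" | "i = 1" | "i \<noteq> 0" "i \<noteq> 1" by blast
      then show ?thesis
        by cases (auto simp: c_def nonzero intro!: continuous_intros)
    qed
  qed (use c_sphere in auto)
  from continuous_map_image_closure_subset[OF this, of "-{0}"]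
  have "c ` closure (-{0}) \<subseteq> nsphere k closure_of (c ` (-{0}))"
    by simp
  moreover have "c 0 \<in> c ` closure (-{0})" by (simp add: closure_complement)
  moreover have "c ` (-{0}) \<subseteq> topspace (punctured_sphere k)"
  proof -
    \<comment> \<open>Coordinate 1 tells the points with nonzero parameter apart from -e.\<close>
    have "c t 1 \<noteq> neg_e0 1" if "t \<noteq> 0" for t
      using that pos[of t] by (simp add: c_def neg_e0_def e0_def)
    then show ?thesis
      using c_sphere unfolding topspace_punctured_sphere
      by (metis Compl_iff DiffI image_subsetI singletonD singletonI)
  qed
  ultimately have "c 0 \<in> nsphere k closure_of topspace (punctured_sphere k)"
    using closure_of_mono by blast
  moreover have "c 0 = neg_e0" by (auto simp: c_def neg_e0_def e0_def)
  ultimately have "neg_e0 \<in> nsphere k closure_of topspace (punctured_sphere k)" by simp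
  moreover have "topspace (punctured_sphere k) \<subseteq> nsphere k closure_of topspace (punctured_sphere k)"
    by (intro closure_of_subset) (auto simp: topspace_punctured_sphere)
  ultimately have "topspace (nsphere k) \<subseteq> nsphere k closure_of topspace (punctured_sphere k)"
    by (auto simp: topspace_punctured_sphere)
  then show ?thesis
    unfolding dense_in_def
    by (intro conjI subset_antisym closure_of_subset_topspace) (auto simp: topspace_punctured_sphere)
qed

text \<open>The closure of X is closed and contains the punctured sphere, which is itself
  dense.\<close>

lemma dense_in_nsphere_if_dense_in_punctured:
  assumes "k > 0" "dense_in (punctured_sphere k) X"
  shows "dense_in (nsphere k) X"
proof -
  have "topspace (punctured_sphere k) \<subseteq> nsphere k closure_of X"
    using assms(2) closure_of_subtopology_subset unfolding dense_in_def punctured_sphere_def by metis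
  then have "nsphere k closure_of topspace (punctured_sphere k) \<subseteq> nsphere k closure_of X"
    by (simp add: closure_of_minimal)
  then have "topspace (nsphere k) \<subseteq> nsphere k closure_of X"
    using punctured_sphere_dense[OF assms(1)] by (simp add: dense_in_def)
  moreover have "X \<subseteq> topspace (nsphere k)"
    using assms(2) unfolding dense_in_def topspace_punctured_sphere by blast
  ultimately show ?thesis
    unfolding dense_in_def by (intro conjI subset_antisym closure_of_subset_topspace)
qed

text \<open>Points are closed in a Hausdorff space, so the punctured sphere is an open
  subspace.\<close>

lemma dense_in_punctured_sphere:
  assumes "dense_in (nsphere k) X"
  shows "dense_in (punctured_sphere k) (X - {neg_e0})"
proof -
  let ?U = "topspace (nsphere k) \<inter> - {neg_e0}"
  have "neg_e0 \<in> topspace (nsphere k)"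
    by (simp add: topspace_nsphere neg_e0_def einner_def sum.lessThan_Suc_shift e0_def del: sum.lessThan_Suc)
  moreover have "Hausdorff_space (nsphere k)"
    by (simp add: nsphere Hausdorff_space_subtopology Hausdorff_space_product_topology)
  ultimately have "closedin (nsphere k) {neg_e0}"
    by (simp add: closedin_Hausdorff_singleton)
  then have "openin (nsphere k) ?U" by (simp add: openin_diff flip: Diff_eq)
  moreover have "punctured_sphere k = subtopology (nsphere k) ?U"
    unfolding punctured_sphere_def by (simp only: subtopology_restrict)
  moreover have "?U \<inter> X = X - {neg_e0}" using assms by (auto simp: dense_in_def)
  ultimately show ?thesis using dense_in_openin assms by metis
qed

subsection \<open>Transport of rational sets\<close>

text \<open>Statement (1), with the preimage under \<open>phi\<close> written as an image under
  \<open>phi_inv\<close>. All norms |y| are rational, so the distance formula keeps distances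
  rational.\<close>

lemma phi_inv_image_hyperbolic:
  assumes k: "k > 0" and dense: "dense_in (tangent_space k) Y" and rat: "rational_set (Suc k) Y"
    and e0: "e0 \<in> Y" and ell: "{edist (Suc k) e0 y | y. y \<in> Y} \<subseteq> pos_elliptic_rationals \<union> {0}"
  shows "dense_in (nsphere k) (phi_inv k ` Y)" "rational_set (Suc k) (phi_inv k ` Y)"
    "e0 \<in> phi_inv k ` Y"
    "{edist (Suc k) e0 x | x. x \<in> phi_inv k ` Y} \<subseteq> (\<lambda>r. 2 * r) ` (pos_hyperbolic_rationals \<union> {0})"
proof -
  have YT: "Y \<subseteq> topspace (tangent_space k)" using dense by (simp add: dense_in_def)
  have N: "edist (Suc k) e0 y \<in> \<rat>" "sqrt (einner (Suc k) y y) \<in> \<rat>" if "y \<in> Y" for y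
  proof -
    have "edist (Suc k) e0 y \<in> pos_elliptic_rationals \<union> {0}" using ell that by blast
    then have "edist (Suc k) e0 y \<in> \<rat> \<and> sqrt (1 + (edist (Suc k) e0 y)\<^sup>2) \<in> \<rat>"
      unfolding elliptic_iff by blast
    moreover have "y \<in> topspace (tangent_space k)" using that YT by blast
    ultimately show "edist (Suc k) e0 y \<in> \<rat>" "sqrt (einner (Suc k) y y) \<in> \<rat>"
      by (simp_all only: einner_tangent_eq)
  qed
  have "homeomorphic_maps (tangent_space k) (punctured_sphere k) (phi_inv k) (phi k)"
    using homeomorphic_maps_phi homeomorphic_maps_sym by blast
  then show d: "dense_in (nsphere k) (phi_inv k ` Y)"
    using dense k dense_in_homeomorphic_maps dense_in_nsphere_if_dense_in_punctured by blast
  show "e0 \<in> phi_inv k ` Y" using e0 phi_inv_e0 by (metis image_eqI)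
  have "phi_inv k ` Y \<subseteq> topspace (Euclidean_space (Suc k))"
    using d unfolding dense_in_def nsphere_def by simp
  moreover have "edist (Suc k) (phi_inv k y) (phi_inv k z) \<in> \<rat>" if "y \<in> Y" "z \<in> Y" for y z
  proof -
    have "edist (Suc k) y z \<in> \<rat>" using rat that by (simp add: rational_set_def)
    moreover have "y \<in> topspace (tangent_space k)" "z \<in> topspace (tangent_space k)"
      using that YT by blast+
    ultimately show ?thesis using that N by (simp add: edist_phi_inv)
  qed
  ultimately show "rational_set (Suc k) (phi_inv k ` Y)"
    unfolding rational_set_def by blast
  have "edist (Suc k) e0 (phi_inv k y) \<in> (\<lambda>r. 2 * r) ` (pos_hyperbolic_rationals \<union> {0})"
    if y: "y \<in> Y" for y
  proof -
    have yT: "y \<in> topspace (tangent_space k)" using YT y by blast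
    define r where "r = edist (Suc k) e0 y"
    define s where "s = sqrt (einner (Suc k) y y)"
    have s: "s > 0" "s\<^sup>2 = 1 + r\<^sup>2" "s \<in> \<rat>" and r: "r \<ge> 0" "r \<in> \<rat>"
      unfolding s_def r_def using N[OF y] einner_tangent_pos[OF yT]
      by (simp_all add: edist_nonneg einner_self_nonneg flip: einner_tangent_eq[OF yT])
    have "r\<^sup>2 \<le> s\<^sup>2" using s by simp
    then have "r \<le> s" using s(1)[THEN less_imp_le] by (rule power2_le_imp_le)
    then have "r / s \<le> 1" using s by simp
    \<comment> \<open>Since s^2 - r^2 = 1, the number h = r/s has sqrt (1 - h^2) = 1/s, which is
      rational.\<close>
    moreover have "1 - (r / s)\<^sup>2 = (s\<^sup>2 - r\<^sup>2) / s\<^sup>2"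
      using s(1) by (simp add: power_divide diff_divide_distrib)
    then have "1 - (r / s)\<^sup>2 = (1 / s)\<^sup>2" by (simp add: s(2) power_one_over)
    then have "sqrt (1 - (r / s)\<^sup>2) = 1 / s" using s by simp
    ultimately have "r / s \<in> pos_hyperbolic_rationals \<union> {0}"
      using s r by (simp only: hyperbolic_iff) simp
    moreover have "edist (Suc k) e0 (phi_inv k y) = 2 * (r / s)"
      using edist_e0_phi_inv[OF yT] by (simp add: r_def s_def)
    ultimately show ?thesis
      by (rule rev_image_eqI)
  qed
  then show "{edist (Suc k) e0 x | x. x \<in> phi_inv k ` Y} \<subseteq> (\<lambda>r. 2 * r) ` (pos_hyperbolic_rationals \<union> {0})"
    by blast
qed

text \<open>The same correspondence read backwards: hyperbolic half-distances to e make the norms of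
  the projected points rational.\<close>

lemma phi_image_elliptic:
  assumes X: "X \<subseteq> topspace (punctured_sphere k)" and rat: "rational_set (Suc k) X"
    and hyp: "{edist (Suc k) e0 x | x. x \<in> X} \<subseteq> (\<lambda>r. 2 * r) ` (pos_hyperbolic_rationals \<union> {0})"
  shows "rational_set (Suc k) (phi k ` X)"
    "{edist (Suc k) e0 y | y. y \<in> phi k ` X} \<subseteq> pos_elliptic_rationals \<union> {0}"
proof -
  have N: "sqrt (einner (Suc k) (phi k P) (phi k P)) \<in> \<rat>"
    and h: "edist (Suc k) e0 P \<in> \<rat>" if "P \<in> X" for P
  proof -
    have P: "P \<in> topspace (punctured_sphere k)" using X that by blast
    then have P': "P \<in> topspace (nsphere k)" by (simp add: topspace_punctured_sphere)
    have "edist (Suc k) e0 P \<in> (\<lambda>r. 2 * r) ` (pos_hyperbolic_rationals \<union> {0})"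
      using hyp that by blast
    then obtain h where h: "edist (Suc k) e0 P = 2 * h" "h \<in> pos_hyperbolic_rationals \<union> {0}"
      by (rule imageE)
    \<comment> \<open>On the unit sphere the squared distance to e is 2 - 2 P_0. Hence 1 - h^2 = (1
      + P_0) / 2, the reciprocal of the squared norm of \<open>phi k P\<close>.\<close>
    have "4 * h\<^sup>2 = 2 - 2 * P 0"
      using edist_power2[of "Suc k" e0 P] P' unfolding h(1) by (simp add: topspace_nsphere)
    then have h2: "1 - h\<^sup>2 = (1 + P 0) / 2" by (simp add: field_simps)
    have "0 \<le> 1 - h\<^sup>2" unfolding h2 using punctured_sphere_0_gt[OF P] by simp
    then have "h\<^sup>2 \<le> 1\<^sup>2" by (simp only: diff_ge_0_iff_ge one_power2)
    then have "h \<le> 1" by (rule power2_le_imp_le) simp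
    then have r: "h \<in> \<rat>" "sqrt (1 - h\<^sup>2) \<in> \<rat>"
      using h(2) unfolding hyperbolic_iff[OF \<open>h \<le> 1\<close>] by blast+
    then show "edist (Suc k) e0 P \<in> \<rat>" using h by simp
    have "einner (Suc k) (phi k P) (phi k P) = 1 / (1 - h\<^sup>2)"
      unfolding einner_phi[OF P] h2 by simp
    then have "sqrt (einner (Suc k) (phi k P) (phi k P)) = 1 / sqrt (1 - h\<^sup>2)"
      by (simp add: real_sqrt_divide)
    then show "sqrt (einner (Suc k) (phi k P) (phi k P)) \<in> \<rat>" using r by simp
  qed
  have dist: "edist (Suc k) (phi k P) (phi k Q) = edist (Suc k) P Q / 2 *
      (sqrt (einner (Suc k) (phi k P) (phi k P)) * sqrt (einner (Suc k) (phi k Q) (phi k Q)))"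
    if "P \<in> topspace (punctured_sphere k)" "Q \<in> topspace (punctured_sphere k)" for P Q
  proof -
    note T = that[THEN phi_in_tangent_space]
    \<comment> \<open>Nonzero norms allow the distance formula of \<open>phi_inv\<close> to be
      solved for the distance in the hyperplane.\<close>
    have "sqrt (einner (Suc k) (phi k P) (phi k P)) * sqrt (einner (Suc k) (phi k Q) (phi k Q)) \<noteq> 0"
      using T[THEN einner_tangent_pos] by simp
    then show ?thesis
      using edist_phi_inv[OF T] unfolding that[THEN phi_inv_phi] by simp
  qed
  have "phi k P \<in> topspace (Euclidean_space (Suc k))" if "P \<in> X" for P
    using phi_in_tangent_space[of P k] X that unfolding tangent_space_def topspace_subtopology by blast
  then have "phi k ` X \<subseteq> topspace (Euclidean_space (Suc k))" by blast
  moreover have "edist (Suc k) (phi k P) (phi k Q) \<in> \<rat>" if "P \<in> X" "Q \<in> X" for P Q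
  proof -
    have "edist (Suc k) P Q \<in> \<rat>" using rat that by (simp add: rational_set_def)
    moreover have "P \<in> topspace (punctured_sphere k)" "Q \<in> topspace (punctured_sphere k)"
      using that X by blast+
    ultimately show ?thesis using that N by (simp add: dist)
  qed
  ultimately show "rational_set (Suc k) (phi k ` X)"
    unfolding rational_set_def by blast
  have "edist (Suc k) e0 (phi k P) \<in> pos_elliptic_rationals \<union> {0}" if P: "P \<in> X" for P
  proof -
    have PS: "P \<in> topspace (punctured_sphere k)" using X P by blast
    have eq: "edist (Suc k) e0 (phi k P) = edist (Suc k) e0 P / 2 * sqrt (einner (Suc k) (phi k P) (phi k P))"
      using dist[OF e0_in_punctured_sphere PS] by (simp add: phi_e0)
    have "edist (Suc k) e0 (phi k P) \<in> \<rat>" unfolding eq using N[OF P] h[OF P] by simp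
    moreover have "sqrt (1 + (edist (Suc k) e0 (phi k P))\<^sup>2) \<in> \<rat>"
      using N[OF P] einner_tangent_eq[OF phi_in_tangent_space[OF PS]] by simp
    ultimately show ?thesis
      unfolding elliptic_iff using edist_nonneg by blast
  qed
  then show "{edist (Suc k) e0 y | y. y \<in> phi k ` X} \<subseteq> pos_elliptic_rationals \<union> {0}"
    by blast
qed

section \<open>Similarities between R^k and the tangent hyperplane\<close>

definition to_tangent :: "(nat \<Rightarrow> real) \<Rightarrow> real \<Rightarrow> (nat \<Rightarrow> real) \<Rightarrow> nat \<Rightarrow> real" where
  "to_tangent P l x = (\<lambda>i. case i of 0 \<Rightarrow> 1 | Suc j \<Rightarrow> (x j - P j) / l)"

definition from_tangent :: "(nat \<Rightarrow> real) \<Rightarrow> real \<Rightarrow> (nat \<Rightarrow> real) \<Rightarrow> nat \<Rightarrow> real" where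
  "from_tangent P l y = (\<lambda>i. P i + l * y (Suc i))"

lemma homeomorphic_maps_to_tangent:
  assumes P: "P \<in> topspace (Euclidean_space k)" and l: "l \<noteq> 0"
  shows "homeomorphic_maps (Euclidean_space k) (tangent_space k) (to_tangent P l) (from_tangent P l)"
  unfolding homeomorphic_maps_def
proof (intro conjI ballI)
  show "continuous_map (Euclidean_space k) (tangent_space k) (to_tangent P l)"
  proof (subst tangent_space_eq, rule continuous_map_subtopology_powertop)
    have cont: "continuous_map (Euclidean_space k) euclideanreal (\<lambda>P. P i)" for i
      by (subst Euclidean_space_eq) (rule continuous_map_coordinate)
    show "continuous_map (Euclidean_space k) euclideanreal (\<lambda>x. to_tangent P l x i)" for i
      using l by (cases i) (auto simp: to_tangent_def intro!: continuous_intros cont)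
    show "to_tangent P l \<in> topspace (Euclidean_space k) \<rightarrow> topspace (tangent_space k)"
      using P by (auto simp: topspace_Euclidean_space topspace_tangent_space to_tangent_def split: nat.split)
  qed
  show "continuous_map (tangent_space k) (Euclidean_space k) (from_tangent P l)"
  proof (subst Euclidean_space_eq, rule continuous_map_subtopology_powertop)
    have cont: "continuous_map (tangent_space k) euclideanreal (\<lambda>P. P i)" for i
      by (subst tangent_space_eq) (rule continuous_map_coordinate)
    show "continuous_map (tangent_space k) euclideanreal (\<lambda>x. from_tangent P l x i)" for i
      by (auto simp: from_tangent_def intro!: continuous_intros cont)
    show "from_tangent P l \<in> topspace (tangent_space k) \<rightarrow> topspace (Euclidean_space k)"
      using P by (auto simp: topspace_Euclidean_space topspace_tangent_space from_tangent_def)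
  qed
qed (use l in \<open>auto simp: to_tangent_def from_tangent_def fun_eq_iff topspace_tangent_space split: nat.split\<close>)

text \<open>The ratio 1/l absorbs the factor of an l-elliptic set, leaving distances to the base
  point that are themselves elliptic.\<close>

lemma edist_to_tangent:
  assumes "l > 0"
  shows "edist (Suc k) (to_tangent P l x) (to_tangent P l y) = edist k x y / l"
proof -
  have "edist (Suc k) (to_tangent P l x) (to_tangent P l y) = sqrt (\<Sum>i<k. ((x i - y i) / l)\<^sup>2)"
    by (simp add: edist_def L2_set_def to_tangent_def sum.lessThan_Suc_shift del: sum.lessThan_Suc
        flip: diff_divide_distrib)
  also have "\<dots> = sqrt ((\<Sum>i<k. (x i - y i)\<^sup>2) / l\<^sup>2)"
    by (simp add: power_divide sum_divide_distrib)
  also have "\<dots> = edist k x y / l"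
    using assms by (simp add: edist_def L2_set_def real_sqrt_divide)
  finally show ?thesis .
qed

lemma to_tangent_base: "to_tangent P l P = e0"
  by (auto simp: to_tangent_def e0_def split: nat.split)

text \<open>Coordinate 0 is 1 for both points and contributes nothing. The way back to R^k is taken
  with ratio 1, because projected distances to e are already elliptic.\<close>

lemma edist_from_tangent:
  assumes "x \<in> topspace (tangent_space k)" "y \<in> topspace (tangent_space k)"
  shows "edist k (from_tangent (\<lambda>i. 0) 1 x) (from_tangent (\<lambda>i. 0) 1 y) = edist (Suc k) x y"
  using assms
  by (simp add: edist_def L2_set_def from_tangent_def sum.lessThan_Suc_shift topspace_tangent_space
      del: sum.lessThan_Suc)

section \<open>Reflections of the sphere\<close>

text \<open>Householder reflection; for \<open>einner n v v = 0\<close> division by zero makes it the identity map.\<close>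

definition reflection :: "nat \<Rightarrow> (nat \<Rightarrow> real) \<Rightarrow> (nat \<Rightarrow> real) \<Rightarrow> nat \<Rightarrow> real" where
  "reflection n v x = (\<lambda>i. 1 * x i + - (2 * einner n x v / einner n v v) * v i)"

lemma einner_reflection: "einner n (reflection n v x) (reflection n v y) = einner n x y"
  unfolding reflection_def einner_lincomb_both
  by (cases "einner n v v = 0") (simp_all add: einner_commute[of n v y])

lemma edist_reflection: "edist n (reflection n v x) (reflection n v y) = edist n x y"
  by (rule power2_eq_imp_eq) (simp_all add: edist_power2 einner_reflection edist_nonneg)

lemma reflection_reflection: "reflection n v (reflection n v x) = x"
proof (cases "einner n v v = 0")
  case False
  have "einner n (reflection n v x) v = - einner n x v"
    unfolding reflection_def einner_lincomb using False by simp
  then show ?thesis by (simp add: reflection_def[of n v "reflection n v x"]) (simp add: reflection_def)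
qed (simp add: reflection_def)

text \<open>For unit vectors P and e, the vector v = P - e satisfies |v|^2 = 2 <P, v>, so the
  reflection subtracts exactly v from P. If P = e, then v = 0 and the map is the identity.\<close>

lemma reflection_to_e0:
  assumes "P \<in> topspace (nsphere k)"
  shows "reflection (Suc k) (\<lambda>i. 1 * P i + -1 * e0 i) P = e0" (is "reflection _ ?v P = e0")
proof (cases "P = e0")
  case False
  then have "P 0 \<noteq> 1" using nsphere_0_eq_1_iff assms by blast
  have PP: "einner (Suc k) P P = 1" using assms by (simp add: topspace_nsphere)
  have "einner (Suc k) ?v P = 1 - P 0"
    unfolding einner_lincomb PP by simp
  then have Pv: "einner (Suc k) P ?v = 1 - P 0"
    by (subst einner_commute)
  have vv: "einner (Suc k) ?v ?v = 2 * (1 - P 0)"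
    unfolding einner_lincomb_both PP by simp
  have "2 * einner (Suc k) P ?v / einner (Suc k) ?v ?v = 1"
    unfolding Pv vv using \<open>P 0 \<noteq> 1\<close> by simp
  then show ?thesis by (simp only: reflection_def) simp
qed (simp add: reflection_def)

text \<open>Inner products are preserved, and the vanishing tail of \<open>v\<close> keeps the
  coordinates above k at 0. Surjectivity holds because the map is an involution.\<close>

lemma reflection_nsphere:
  assumes "\<forall>i>k. v i = 0"
  shows "reflection (Suc k) v ` topspace (nsphere k) = topspace (nsphere k)"
proof -
  have *: "reflection (Suc k) v x \<in> topspace (nsphere k)" if "x \<in> topspace (nsphere k)" for x
    using that assms by (simp add: topspace_nsphere einner_reflection) (simp add: reflection_def)
  then show ?thesis
    by (metis (no_types, lifting) image_eqI image_subsetI reflection_reflection subsetI subset_antisym)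
qed

lemma continuous_map_reflection:
  assumes "\<forall>i>k. v i = 0"
  shows "continuous_map (nsphere k) (nsphere k) (reflection (Suc k) v)"
proof (subst (2) nsphere_eq, rule continuous_map_subtopology_powertop)
  show "continuous_map (nsphere k) euclideanreal (\<lambda>x. reflection (Suc k) v x i)" for i
    unfolding reflection_def einner_def divide_inverse
    by (intro continuous_intros continuous_map_nsphere_projection) auto
qed (use reflection_nsphere[OF assms] in auto)

text \<open>A similarity carries X into the hyperplane with its base point at e, and
  \<open>phi_inv\<close> carries the result to the sphere.\<close>

lemma elliptic_imp_hyperbolic:
  assumes k: "k > 0" and ell: "elliptic_rational_set k X" and dense: "dense_in (Euclidean_space k) X"
  shows "\<exists>X'. l_hyperbolic_rational_set (Suc k) 2 X' \<and> dense_in (nsphere k) X'"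
proof -
  obtain l P where l: "l \<in> \<rat>" "l > 0" and rat: "rational_set k X" and P: "P \<in> X"
    and sub: "{edist k P x | x. x \<in> X} \<subseteq> (\<lambda>r. l * r) ` (pos_elliptic_rationals \<union> {0})"
    using ell unfolding elliptic_rational_set_def l_elliptic_rational_set_def
    by (elim exE conjE bexE)
  define Y where "Y = to_tangent P l ` X"
  have PE: "P \<in> topspace (Euclidean_space k)" using P dense unfolding dense_in_def by blast
  have dY: "dense_in (tangent_space k) Y"
    unfolding Y_def using l
    by (intro dense_in_homeomorphic_maps[OF homeomorphic_maps_to_tangent[OF PE] dense]) simp
  then have "Y \<subseteq> topspace (Euclidean_space (Suc k))"
    unfolding dense_in_def tangent_space_def topspace_subtopology by blast
  moreover have "edist (Suc k) (to_tangent P l x) (to_tangent P l y) \<in> \<rat>" if "x \<in> X" "y \<in> X" for x y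
    using rat l that by (simp add: rational_set_def edist_to_tangent)
  ultimately have rY: "rational_set (Suc k) Y"
    unfolding rational_set_def Y_def by blast
  have eY: "e0 \<in> Y" unfolding Y_def using P to_tangent_base by (metis image_eqI)
  have sY: "{edist (Suc k) e0 y | y. y \<in> Y} \<subseteq> pos_elliptic_rationals \<union> {0}"
  proof (clarify del: UnCI)
    fix y assume "y \<in> Y"
    then obtain x where x: "x \<in> X" "y = to_tangent P l x" unfolding Y_def by blast
    have "edist k P x \<in> (\<lambda>r. l * r) ` (pos_elliptic_rationals \<union> {0})"
      using sub x(1) by blast
    then obtain r where r: "edist k P x = l * r" "r \<in> pos_elliptic_rationals \<union> {0}"
      by (rule imageE)
    have "edist (Suc k) e0 y = edist k P x / l"
      using edist_to_tangent[OF l(2), of k P P x] by (simp add: x to_tangent_base)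
    then show "edist (Suc k) e0 y \<in> pos_elliptic_rationals \<union> {0}" using r l by simp
  qed
  note * = phi_inv_image_hyperbolic[OF k dY rY eY sY]
  have "l_hyperbolic_rational_set (Suc k) 2 (phi_inv k ` Y)"
    unfolding l_hyperbolic_rational_set_def
    by (intro conjI bexI[OF _ *(3)] *(2,4)) simp_all
  with *(1) show ?thesis by blast
qed

text \<open>A reflection moves the base point to e, \<open>phi\<close> projects to the hyperplane,
  and dropping coordinate 0 lands in R^k.\<close>

lemma hyperbolic_imp_elliptic:
  assumes hyp: "l_hyperbolic_rational_set (Suc k) 2 X" and dense: "dense_in (nsphere k) X"
  shows "\<exists>X'. elliptic_rational_set k X' \<and> dense_in (Euclidean_space k) X'"
proof -
  obtain P where rat: "rational_set (Suc k) X" and P: "P \<in> X"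
    and sub: "{edist (Suc k) P x | x. x \<in> X} \<subseteq> (\<lambda>r. 2 * r) ` (pos_hyperbolic_rationals \<union> {0})"
    using hyp unfolding l_hyperbolic_rational_set_def
    by (elim conjE bexE)
  have PS: "P \<in> topspace (nsphere k)" using P dense unfolding dense_in_def by blast
  define v where "v = (\<lambda>i. 1 * P i + -1 * e0 i)"
  have v: "\<forall>i>k. v i = 0" using PS by (auto simp: v_def topspace_nsphere e0_def)
  define R where "R = reflection (Suc k) v"
  have RP: "R P = e0" unfolding R_def v_def by (rule reflection_to_e0[OF PS])
  \<comment> \<open>The projection is defined only away from -e. Discarding this one point preserves
    density and keeps e.\<close>
  define Z where "Z = R ` X - {neg_e0}"
  have dR: "dense_in (nsphere k) (R ` X)"
    using dense_in_continuous_image[OF continuous_map_reflection[OF v] reflection_nsphere[OF v] dense]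
    by (simp add: R_def)
  then have dZ: "dense_in (punctured_sphere k) Z"
    unfolding Z_def by (rule dense_in_punctured_sphere)
  then have ZS: "Z \<subseteq> topspace (punctured_sphere k)" by (simp add: dense_in_def)
  then have "Z \<subseteq> topspace (Euclidean_space (Suc k))"
    unfolding topspace_punctured_sphere nsphere_def topspace_subtopology by blast
  moreover have "edist (Suc k) (R x) (R y) \<in> \<rat>" if "x \<in> X" "y \<in> X" for x y
    using rat that by (simp add: rational_set_def R_def edist_reflection)
  ultimately have rZ: "rational_set (Suc k) Z"
    unfolding rational_set_def Z_def by blast
  have "edist (Suc k) e0 (R x) = edist (Suc k) P x" for x
    using edist_reflection[of "Suc k" v P x] RP by (simp add: R_def)
  then have "{edist (Suc k) e0 z | z. z \<in> Z} \<subseteq> {edist (Suc k) P x | x. x \<in> X}"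
    unfolding Z_def by blast
  then have sZ: "{edist (Suc k) e0 z | z. z \<in> Z} \<subseteq> (\<lambda>r. 2 * r) ` (pos_hyperbolic_rationals \<union> {0})"
    using sub by (rule subset_trans)
  have eZ: "e0 \<in> Z"
    unfolding Z_def using P RP[symmetric] e0_neq_neg_e0 by (intro DiffI rev_image_eqI) simp_all
  note * = phi_image_elliptic[OF ZS rZ sZ]
  define Y where "Y = phi k ` Z"
  have dY: "dense_in (tangent_space k) Y"
    unfolding Y_def using dense_in_homeomorphic_maps[OF homeomorphic_maps_phi dZ] .
  then have YT: "Y \<subseteq> topspace (tangent_space k)" by (simp add: dense_in_def)
  have eY: "e0 \<in> Y" unfolding Y_def using eZ phi_e0 by (metis image_eqI)
  define g where "g = from_tangent (\<lambda>i. 0) 1"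
  have "homeomorphic_maps (tangent_space k) (Euclidean_space k) g (to_tangent (\<lambda>i. 0) 1)"
    unfolding g_def using homeomorphic_maps_to_tangent[of "\<lambda>i. 0" k 1] homeomorphic_maps_sym
    by (auto simp: topspace_Euclidean_space)
  then have dX: "dense_in (Euclidean_space k) (g ` Y)"
    using dense_in_homeomorphic_maps dY by blast
  have dist: "edist k (g x) (g y) = edist (Suc k) x y" if "x \<in> Y" "y \<in> Y" for x y
    unfolding g_def using that YT by (intro edist_from_tangent) auto
  have "rational_set k (g ` Y)"
    using dX *(1) dist unfolding rational_set_def Y_def[symmetric] dense_in_def by simp
  moreover have "{edist k (g e0) x | x. x \<in> g ` Y} \<subseteq> (\<lambda>r. 1 * r) ` (pos_elliptic_rationals \<union> {0})"
  proof -
    have "{edist k (g e0) x | x. x \<in> g ` Y} \<subseteq> {edist (Suc k) e0 y | y. y \<in> Y}"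
      using dist[OF eY] by blast
    then show ?thesis using *(2) unfolding Y_def[symmetric] by simp
  qed
  ultimately have "l_elliptic_rational_set k 1 (g ` Y)"
    unfolding l_elliptic_rational_set_def using imageI[OF eY] by (intro conjI bexI) simp_all
  then show ?thesis using dX unfolding elliptic_rational_set_def by blast
qed

theorem theorem3p5:
  shows "(\<forall>k>0.
            homeomorphic_map (punctured_sphere k) (tangent_space k) (phi k) \<and>
            phi k e0 = e0 \<and>
            (\<forall>Y. dense_in (tangent_space k) Y \<and> rational_set (Suc k) Y \<and> e0 \<in> Y \<and>
                 {edist (Suc k) e0 y | y. y \<in> Y} \<subseteq> pos_elliptic_rationals \<union> {0} \<longrightarrow>
                 (let X = {P \<in> topspace (punctured_sphere k). phi k P \<in> Y} in
                    dense_in (nsphere k) X \<and> rational_set (Suc k) X \<and> e0 \<in> X \<and>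
                    {edist (Suc k) e0 x | x. x \<in> X}
                      \<subseteq> (\<lambda>r. 2 * r) ` (pos_hyperbolic_rationals \<union> {0})))) \<and>
         ((\<forall>k>0. \<exists>X. elliptic_rational_set k X \<and> dense_in (Euclidean_space k) X) \<longleftrightarrow>
          (\<forall>k>0. \<exists>X. l_hyperbolic_rational_set (Suc k) 2 X \<and> dense_in (nsphere k) X)) \<and>
         (\<forall>k>0. (\<exists>X. elliptic_rational_set k X \<and> dense_in (Euclidean_space k) X) \<longleftrightarrow>
                (\<exists>X. l_hyperbolic_rational_set (Suc k) 2 X \<and> dense_in (nsphere k) X))"
proof -
  have part1: "homeomorphic_map (punctured_sphere k) (tangent_space k) (phi k)" for k
    using homeomorphic_maps_phi by (rule homeomorphic_maps_imp_map)
  have part2: "let X = {P \<in> topspace (punctured_sphere k). phi k P \<in> Y} in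
      dense_in (nsphere k) X \<and> rational_set (Suc k) X \<and> e0 \<in> X \<and>
      {edist (Suc k) e0 x | x. x \<in> X} \<subseteq> (\<lambda>r. 2 * r) ` (pos_hyperbolic_rationals \<union> {0})"
    if "k > 0" and Y: "dense_in (tangent_space k) Y" "rational_set (Suc k) Y" "e0 \<in> Y"
      "{edist (Suc k) e0 y | y. y \<in> Y} \<subseteq> pos_elliptic_rationals \<union> {0}" for k Y
  proof -
    have "{P \<in> topspace (punctured_sphere k). phi k P \<in> Y} = phi_inv k ` Y"
      using Y(1) by (intro phi_preimage) (simp add: dense_in_def)
    then show ?thesis
      unfolding Let_def using phi_inv_image_hyperbolic[OF that] by (simp only:)
  qed
  have part3: "(\<exists>X. elliptic_rational_set k X \<and> dense_in (Euclidean_space k) X) \<longleftrightarrow>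
      (\<exists>X. l_hyperbolic_rational_set (Suc k) 2 X \<and> dense_in (nsphere k) X)" if "k > 0" for k
    using elliptic_imp_hyperbolic[OF that] hyperbolic_imp_elliptic[of k] by blast
  show ?thesis
  proof (intro conjI)
    show "\<forall>k>0. homeomorphic_map (punctured_sphere k) (tangent_space k) (phi k) \<and>
            phi k e0 = e0 \<and>
            (\<forall>Y. dense_in (tangent_space k) Y \<and> rational_set (Suc k) Y \<and> e0 \<in> Y \<and>
                 {edist (Suc k) e0 y | y. y \<in> Y} \<subseteq> pos_elliptic_rationals \<union> {0} \<longrightarrow>
                 (let X = {P \<in> topspace (punctured_sphere k). phi k P \<in> Y} in
                    dense_in (nsphere k) X \<and> rational_set (Suc k) X \<and> e0 \<in> X \<and>
                    {edist (Suc k) e0 x | x. x \<in> X}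
                      \<subseteq> (\<lambda>r. 2 * r) ` (pos_hyperbolic_rationals \<union> {0})))"
      by (intro allI impI conjI part1 phi_e0, elim conjE) (rule part2)
  \<comment> \<open>The equivalence between the two statements for all k is inherited from the
    equivalence at each fixed k.\<close>
  qed (rule all_cong, erule part3, intro allI impI, erule part3)
qed

end
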